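(* Let $\mathbb{R}^3(-3)$ be $\mathbb{R}^3$ with coordinates $(x,y,z)$ and the Riemannian metric $g=\frac14(dx^2+dy^2)+\eta\otimes\eta$, where $\eta=\frac12(dz-y\,dx)$, and let $\xi=2\frac{\partial}{\partial z}$. Endow it with the semi-symmetric metric connection $\widetilde{\nabla}$ associated with the unit vector field $U=\xi$, that is, $\widetilde{\nabla}_VW=\nabla_VW+g(W,U)V-g(V,W)U$, where $\nabla$ is the Levi-Civita connection of $g$. Let $\gamma:I\to\mathbb{R}^3(-3)$, $\gamma(s)=(\gamma_1(s),\gamma_2(s),\gamma_3(s))$, be a semi-symmetric Frenet curve, where $s$ is the arc-length parameter. Then $\gamma$ is a semi-symmetric geodesic if and only if it satisfies the system of non-linear differential equations $\lambda=0$, $\mu=0$, $\nu=0$ together with $$(\gamma_1')^2+(\gamma_2')^2+(\gamma_3'-\gamma_1'\gamma_2)^2=4,$$ where $$\lambda=\gamma_2''-\tfrac12\gamma_2\gamma_1'\gamma_2'-\gamma_2(\gamma_1')^2+\gamma_1'\gamma_3'+\tfrac12\gamma_2'\gamma_3',$$ $$\mu=\gamma_1''+\gamma_2\gamma_1'\gamma_2'-\tfrac12\gamma_2(\gamma_1')^2+\tfrac12\gamma_1'\gamma_3'-\gamma_2'\gamma_3',$$ $$\nu=-\tfrac12(\gamma_1')^2-\tfrac12(\gamma_2')^2+\gamma_3''-\gamma_1''\gamma_2-\gamma_1'\gamma_2'.$$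
   Context: Here $I\subseteq\mathbb{R}$ is an open interval. Let $(M,g)$ be a 3-dimensional Riemannian manifold with a metric connection $\widetilde{\nabla}$ of the form $\widetilde{\nabla}_VW=\nabla_VW+g(W,U)V-g(V,W)U$, where $\nabla$ is the Levi-Civita connection of $g$ and $U$ is a vector field on $M$, and let $\gamma:I\to M$ be a smooth unit-speed curve (with respect to $g$) with tangent $T=\gamma'$. Its semi-symmetric curvature is $\widetilde{\kappa}=\|\widetilde{\nabla}_TT\|$. The curve is a semi-symmetric geodesic (equivalently, a semi-symmetric Frenet curve of order 1) if $\widetilde{\nabla}_TT=0$ along $\gamma$. If $\widetilde{\nabla}_TT\neq 0$ along $\gamma$, its semi-symmetric normal is $N=\widetilde{\nabla}_TT/\widetilde{\kappa}$, and $\gamma$ is a semi-symmetric Frenet curve of order 2 if $\widetilde{\nabla}_TN$ is parallel to $T$ (i.e. $\widetilde{\nabla}_TN=\rho T$ for some function $\rho$), and of order 3 if $\widetilde{\nabla}_TN$ is not parallel to $T$. A semi-symmetric Frenet curve is one of order 1, 2 or 3; in particular it is smooth and unit-speed. *)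

theory Defs
  imports "HOL-Analysis.Analysis"
begin

text \<open>
  Manifolds here are \<open>\<real>\<^sup>3\<close> with its global chart: every tangent space is identified with
  \<open>real^3\<close> through the coordinate basis, so a vector field is a map \<open>real^3 \<Rightarrow> real^3\<close>, and the
  coordinate fields are the constant maps with values \<open>axis i 1\<close>.
\<close>

type_synonym vfield = "real^3 \<Rightarrow> real^3"
type_synonym metric = "real^3 \<Rightarrow> real^3 \<Rightarrow> real^3 \<Rightarrow> real"
type_synonym connection = "vfield \<Rightarrow> vfield \<Rightarrow> vfield"

text \<open>To be used on open sets \<open>S\<close> only.\<close>

primrec Ck_on ::
  "nat \<Rightarrow> 'a::euclidean_space set \<Rightarrow> ('a \<Rightarrow> 'b::real_normed_vector) \<Rightarrow> bool" where
  "Ck_on 0 S f \<longleftrightarrow> continuous_on S f"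
| "Ck_on (Suc k) S f \<longleftrightarrow> (\<forall>x\<in>S. f differentiable at x) \<and>
     (\<forall>b\<in>Basis. Ck_on k S (\<lambda>x. frechet_derivative f (at x) b))"

definition smooth_on ::
  "'a::euclidean_space set \<Rightarrow> ('a \<Rightarrow> 'b::real_normed_vector) \<Rightarrow> bool" where
  "smooth_on S f \<longleftrightarrow> (\<forall>k. Ck_on k S f)"

definition riemannian_metric :: "metric \<Rightarrow> bool" where
  "riemannian_metric g \<longleftrightarrow>
     (\<forall>p. bilinear (g p)) \<and> (\<forall>p v w. g p v w = g p w v) \<and> (\<forall>p v. v \<noteq> 0 \<longrightarrow> g p v v > 0) \<and>
     (\<forall>v w. smooth_on UNIV (\<lambda>p. g p v w))"

definition lie_bracket :: "vfield \<Rightarrow> vfield \<Rightarrow> vfield" where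
  "lie_bracket V W p = frechet_derivative W (at p) (V p) - frechet_derivative V (at p) (W p)"

definition affine_connection :: "connection \<Rightarrow> bool" where
  "affine_connection D \<longleftrightarrow>
     (\<forall>V W. smooth_on UNIV V \<longrightarrow> smooth_on UNIV W \<longrightarrow> smooth_on UNIV (D V W)) \<and>
     (\<forall>V V' W. smooth_on UNIV V \<longrightarrow> smooth_on UNIV V' \<longrightarrow> smooth_on UNIV W \<longrightarrow>
        D (\<lambda>p. V p + V' p) W = (\<lambda>p. D V W p + D V' W p)) \<and>
     (\<forall>(f :: real^3 \<Rightarrow> real) V W. smooth_on UNIV f \<longrightarrow> smooth_on UNIV V \<longrightarrow> smooth_on UNIV W \<longrightarrow>
        D (\<lambda>p. f p *\<^sub>R V p) W = (\<lambda>p. f p *\<^sub>R D V W p)) \<and>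
     (\<forall>V W W'. smooth_on UNIV V \<longrightarrow> smooth_on UNIV W \<longrightarrow> smooth_on UNIV W' \<longrightarrow>
        D V (\<lambda>p. W p + W' p) = (\<lambda>p. D V W p + D V W' p)) \<and>
     (\<forall>(f :: real^3 \<Rightarrow> real) V W. smooth_on UNIV f \<longrightarrow> smooth_on UNIV V \<longrightarrow> smooth_on UNIV W \<longrightarrow>
        D V (\<lambda>p. f p *\<^sub>R W p) =
          (\<lambda>p. f p *\<^sub>R D V W p + frechet_derivative f (at p) (V p) *\<^sub>R W p))"

definition torsion_free :: "connection \<Rightarrow> bool" where
  "torsion_free D \<longleftrightarrow> (\<forall>V W. smooth_on UNIV V \<longrightarrow> smooth_on UNIV W \<longrightarrow>
     (\<forall>p. D V W p - D W V p = lie_bracket V W p))"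

definition metric_compatible :: "metric \<Rightarrow> connection \<Rightarrow> bool" where
  "metric_compatible g D \<longleftrightarrow>
     (\<forall>X V W. smooth_on UNIV X \<longrightarrow> smooth_on UNIV V \<longrightarrow> smooth_on UNIV W \<longrightarrow>
       (\<forall>p. frechet_derivative (\<lambda>q. g q (V q) (W q)) (at p) (X p) =
            g p (D X V p) (W p) + g p (V p) (D X W p)))"

definition levi_civita_connection :: "metric \<Rightarrow> connection \<Rightarrow> bool" where
  "levi_civita_connection g D \<longleftrightarrow>
     affine_connection D \<and> torsion_free D \<and> metric_compatible g D"

definition semi_symmetric_connection :: "metric \<Rightarrow> vfield \<Rightarrow> connection \<Rightarrow> connection" where
  "semi_symmetric_connection g U D V W =
     (\<lambda>p. D V W p + g p (W p) (U p) *\<^sub>R V p - g p (V p) (W p) *\<^sub>R U p)"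

definition tangent :: "(real \<Rightarrow> real^3) \<Rightarrow> real \<Rightarrow> real^3" where
  "tangent \<gamma> s = vector_derivative \<gamma> (at s)"

text \<open>
  The covariant derivative, along \<open>\<gamma>\<close> in direction \<open>\<gamma>'\<close>, of a field \<open>W\<close> along \<open>\<gamma>\<close>:
  in the global chart it is \<open>W' + \<Sum>i j. (\<gamma>\<^sub>i)' W\<^sub>j (D\<^bsub>\<partial>\<^sub>i\<^esub> \<partial>\<^sub>j)(\<gamma>)\<close>.
\<close>

definition cov_deriv_along ::
  "connection \<Rightarrow> (real \<Rightarrow> real^3) \<Rightarrow> (real \<Rightarrow> real^3) \<Rightarrow> real \<Rightarrow> real^3" where
  "cov_deriv_along D \<gamma> W s = vector_derivative W (at s) +
     (\<Sum>i\<in>UNIV. \<Sum>j\<in>UNIV.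
        (tangent \<gamma> s $ i * W s $ j) *\<^sub>R D (\<lambda>_. axis i 1) (\<lambda>_. axis j 1) (\<gamma> s))"

definition unit_speed_curve :: "metric \<Rightarrow> real set \<Rightarrow> (real \<Rightarrow> real^3) \<Rightarrow> bool" where
  "unit_speed_curve g I \<gamma> \<longleftrightarrow>
     smooth_on I \<gamma> \<and> (\<forall>s\<in>I. sqrt (g (\<gamma> s) (tangent \<gamma> s) (tangent \<gamma> s)) = 1)"

text \<open>In the following, \<open>D\<close> stands for the semi-symmetric metric connection.\<close>

definition accel :: "connection \<Rightarrow> (real \<Rightarrow> real^3) \<Rightarrow> real \<Rightarrow> real^3" where
  "accel D \<gamma> = cov_deriv_along D \<gamma> (tangent \<gamma>)"

definition curvature :: "metric \<Rightarrow> connection \<Rightarrow> (real \<Rightarrow> real^3) \<Rightarrow> real \<Rightarrow> real" where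
  "curvature g D \<gamma> s = sqrt (g (\<gamma> s) (accel D \<gamma> s) (accel D \<gamma> s))"

definition normal :: "metric \<Rightarrow> connection \<Rightarrow> (real \<Rightarrow> real^3) \<Rightarrow> real \<Rightarrow> real^3" where
  "normal g D \<gamma> s = accel D \<gamma> s /\<^sub>R curvature g D \<gamma> s"

definition geodesic :: "metric \<Rightarrow> connection \<Rightarrow> real set \<Rightarrow> (real \<Rightarrow> real^3) \<Rightarrow> bool" where
  "geodesic g D I \<gamma> \<longleftrightarrow> unit_speed_curve g I \<gamma> \<and> (\<forall>s\<in>I. accel D \<gamma> s = 0)"

definition normal_deriv_parallel_tangent ::
  "metric \<Rightarrow> connection \<Rightarrow> real set \<Rightarrow> (real \<Rightarrow> real^3) \<Rightarrow> bool" where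
  "normal_deriv_parallel_tangent g D I \<gamma> \<longleftrightarrow>
     (\<exists>\<rho> :: real \<Rightarrow> real. \<forall>s\<in>I. cov_deriv_along D \<gamma> (normal g D \<gamma>) s = \<rho> s *\<^sub>R tangent \<gamma> s)"

definition frenet_order2 :: "metric \<Rightarrow> connection \<Rightarrow> real set \<Rightarrow> (real \<Rightarrow> real^3) \<Rightarrow> bool" where
  "frenet_order2 g D I \<gamma> \<longleftrightarrow> unit_speed_curve g I \<gamma> \<and> (\<forall>s\<in>I. accel D \<gamma> s \<noteq> 0) \<and>
     normal_deriv_parallel_tangent g D I \<gamma>"

definition frenet_order3 :: "metric \<Rightarrow> connection \<Rightarrow> real set \<Rightarrow> (real \<Rightarrow> real^3) \<Rightarrow> bool" where
  "frenet_order3 g D I \<gamma> \<longleftrightarrow> unit_speed_curve g I \<gamma> \<and> (\<forall>s\<in>I. accel D \<gamma> s \<noteq> 0) \<and>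
     \<not> normal_deriv_parallel_tangent g D I \<gamma>"

text \<open>A geodesic is a Frenet curve of order 1.\<close>

definition frenet_curve :: "metric \<Rightarrow> connection \<Rightarrow> real set \<Rightarrow> (real \<Rightarrow> real^3) \<Rightarrow> bool" where
  "frenet_curve g D I \<gamma> \<longleftrightarrow>
     geodesic g D I \<gamma> \<or> frenet_order2 g D I \<gamma> \<or> frenet_order3 g D I \<gamma>"

definition \<eta> :: "real^3 \<Rightarrow> real^3 \<Rightarrow> real" where
  "\<eta> p v = (v $ 3 - p $ 2 * v $ 1) / 2"

definition g_sasaki :: metric where
  "g_sasaki p v w = (v $ 1 * w $ 1 + v $ 2 * w $ 2) / 4 + \<eta> p v * \<eta> p w"

definition \<xi> :: vfield where
  "\<xi> p = 2 *\<^sub>R axis 3 1"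

definition ode_lambda ::
  "(real \<Rightarrow> real) \<Rightarrow> (real \<Rightarrow> real) \<Rightarrow> (real \<Rightarrow> real) \<Rightarrow> real \<Rightarrow> real" where
  "ode_lambda \<gamma>1 \<gamma>2 \<gamma>3 s =
     deriv (deriv \<gamma>2) s - 1/2 * \<gamma>2 s * deriv \<gamma>1 s * deriv \<gamma>2 s - \<gamma>2 s * (deriv \<gamma>1 s)\<^sup>2
     + deriv \<gamma>1 s * deriv \<gamma>3 s + 1/2 * deriv \<gamma>2 s * deriv \<gamma>3 s"

definition ode_mu ::
  "(real \<Rightarrow> real) \<Rightarrow> (real \<Rightarrow> real) \<Rightarrow> (real \<Rightarrow> real) \<Rightarrow> real \<Rightarrow> real" where
  "ode_mu \<gamma>1 \<gamma>2 \<gamma>3 s =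
     deriv (deriv \<gamma>1) s + \<gamma>2 s * deriv \<gamma>1 s * deriv \<gamma>2 s - 1/2 * \<gamma>2 s * (deriv \<gamma>1 s)\<^sup>2
     + 1/2 * deriv \<gamma>1 s * deriv \<gamma>3 s - deriv \<gamma>2 s * deriv \<gamma>3 s"

definition ode_nu ::
  "(real \<Rightarrow> real) \<Rightarrow> (real \<Rightarrow> real) \<Rightarrow> (real \<Rightarrow> real) \<Rightarrow> real \<Rightarrow> real" where
  "ode_nu \<gamma>1 \<gamma>2 \<gamma>3 s =
     - 1/2 * (deriv \<gamma>1 s)\<^sup>2 - 1/2 * (deriv \<gamma>2 s)\<^sup>2
     + deriv (deriv \<gamma>3) s - deriv (deriv \<gamma>1) s * \<gamma>2 s - deriv \<gamma>1 s * deriv \<gamma>2 s"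

text \<open>
  Consistency of the definitions: \<open>g_sasaki\<close> is a Riemannian metric that has a Levi-Civita
  connection; the chart formula \<open>cov_deriv_along\<close> is the restriction to curves of the connection,
  and for the semi-symmetric connection it gives the expected expression in terms of \<open>D\<close>.
\<close>


lemma Ck_on_SucD: "Ck_on (Suc k) S f \<Longrightarrow> Ck_on k S f"
proof (induction k arbitrary: f)
  case 0
  then show ?case
    by (auto intro!: continuous_at_imp_continuous_on differentiable_imp_continuous_within)
next
  case (Suc k)
  have "Ck_on (Suc k) S (\<lambda>x. frechet_derivative f (at x) b)" if "b \<in> Basis" for b
    using Suc.prems that by (simp only: Ck_on.simps(2)[of "Suc k"])
  then show ?case using Suc.IH Suc.prems unfolding Ck_on.simps(2)[of k] Ck_on.simps(2)[of "Suc k"] by blast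
qed

lemma Ck_on_const: "Ck_on k S (\<lambda>x. c)"
proof (induction k arbitrary: c)
  case (Suc k)
  have "frechet_derivative (\<lambda>x. c) (at x) = (\<lambda>v. 0)" for x :: 'a
    by (rule frechet_derivative_at[symmetric]) simp
  then show ?case using Suc by simp
qed simp

lemma Ck_on_linear:
  assumes "bounded_linear L"
  shows "Ck_on k UNIV f \<Longrightarrow> Ck_on k UNIV (\<lambda>x. L (f x))"
proof (induction k arbitrary: f)
  case 0
  then show ?case using assms by (simp add: bounded_linear.continuous_on)
next
  case (Suc k)
  have d: "((\<lambda>x. L (f x)) has_derivative (\<lambda>v. L (frechet_derivative f (at x) v))) (at x)" for x
    using Suc.prems by (auto intro!: bounded_linear.has_derivative[OF assms] simp: frechet_derivative_works)
  show ?case using Suc frechet_derivative_at[OF d, symmetric] differentiableI[OF d]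
    by auto
qed

lemma Ck_on_add: "Ck_on k UNIV f \<Longrightarrow> Ck_on k UNIV g \<Longrightarrow> Ck_on k UNIV (\<lambda>x. f x + g x)"
proof (induction k arbitrary: f g)
  case 0
  then show ?case by (simp add: continuous_on_add)
next
  case (Suc k)
  have d: "((\<lambda>x. f x + g x) has_derivative
      (\<lambda>v. frechet_derivative f (at x) v + frechet_derivative g (at x) v)) (at x)" for x
    using Suc.prems by (auto intro!: has_derivative_add simp: frechet_derivative_works)
  show ?case using Suc frechet_derivative_at[OF d, symmetric] differentiableI[OF d]
    by auto
qed

lemma Ck_on_bilinear:
  assumes "bounded_bilinear h"
  shows "Ck_on k UNIV f \<Longrightarrow> Ck_on k UNIV g \<Longrightarrow> Ck_on k UNIV (\<lambda>x. h (f x) (g x))"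
proof (induction k arbitrary: f g)
  case 0
  then show ?case using assms by (simp add: bounded_bilinear.continuous_on)
next
  case (Suc k)
  have d: "((\<lambda>x. h (f x) (g x)) has_derivative
      (\<lambda>v. h (f x) (frechet_derivative g (at x) v) + h (frechet_derivative f (at x) v) (g x))) (at x)" for x
    using Suc.prems by (auto intro!: bounded_bilinear.FDERIV[OF assms] simp: frechet_derivative_works)
  have "Ck_on k UNIV f" "Ck_on k UNIV g" using Suc.prems by (auto intro: Ck_on_SucD)
  then show ?case using Suc frechet_derivative_at[OF d, symmetric] differentiableI[OF d]
    by (auto intro!: Ck_on_add)
qed

lemma smooth_on_const: "smooth_on UNIV (\<lambda>x. c)"
  and smooth_on_linear: "bounded_linear L \<Longrightarrow> smooth_on UNIV f \<Longrightarrow> smooth_on UNIV (\<lambda>x. L (f x))"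
  and smooth_on_add: "smooth_on UNIV f \<Longrightarrow> smooth_on UNIV g \<Longrightarrow> smooth_on UNIV (\<lambda>x. f x + g x)"
  and smooth_on_bilinear: "bounded_bilinear h \<Longrightarrow> smooth_on UNIV f1 \<Longrightarrow> smooth_on UNIV f2 \<Longrightarrow>
      smooth_on UNIV (\<lambda>x. h (f1 x) (f2 x))"
  by (simp_all add: smooth_on_def Ck_on_const Ck_on_linear Ck_on_add Ck_on_bilinear)

lemma smooth_on_id: "smooth_on UNIV (\<lambda>x. x)"
proof -
  have "frechet_derivative (\<lambda>x. x) (at x) = (\<lambda>v. v)" for x :: 'a
    by (rule frechet_derivative_at[symmetric]) simp
  then have "Ck_on k UNIV (\<lambda>x::'a. x)" for k by (cases k) (simp_all add: Ck_on_const)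
  then show ?thesis by (simp add: smooth_on_def)
qed

lemmas smooth_intros = smooth_on_const smooth_on_id smooth_on_add
  smooth_on_linear[OF bounded_linear_vec_nth]
  smooth_on_bilinear[OF bounded_bilinear_mult]
  smooth_on_bilinear[OF bounded_bilinear_scaleR]

lemma smooth_on_differentiable: "smooth_on S f \<Longrightarrow> x \<in> S \<Longrightarrow> f differentiable at x"
  unfolding smooth_on_def by (auto dest: spec[of _ "Suc 0"])

lemma smooth_on_directional:
  fixes V :: vfield and f :: "real^3 \<Rightarrow> 'b::real_normed_vector"
  assumes "smooth_on UNIV V" "smooth_on UNIV f"
  shows "smooth_on UNIV (\<lambda>p. frechet_derivative f (at p) (V p))"
proof -
  have e: "v = v $ 1 *\<^sub>R axis 1 1 + v $ 2 *\<^sub>R axis 2 1 + v $ 3 *\<^sub>R axis 3 1" for v :: "real^3"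
    by (simp add: vec_eq_iff forall_3 axis_def)
  have "frechet_derivative f (at p) (V p) = V p $ 1 *\<^sub>R frechet_derivative f (at p) (axis 1 1) +
     V p $ 2 *\<^sub>R frechet_derivative f (at p) (axis 2 1) + V p $ 3 *\<^sub>R frechet_derivative f (at p) (axis 3 1)" for p
  proof -
    have "linear (frechet_derivative f (at p))"
      using assms(2) by (simp add: linear_frechet_derivative smooth_on_differentiable)
    then show ?thesis by (subst e[of "V p"]) (simp only: linear_add linear_scale)
  qed
  moreover have "smooth_on UNIV (\<lambda>p. frechet_derivative f (at p) (axis i 1))" for i
  proof -
    have b: "axis i 1 \<in> (Basis :: (real^3) set)" by (simp add: axis_in_Basis_iff)
    have "Ck_on (Suc k) UNIV f" for k using assms(2) by (simp add: smooth_on_def)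
    then show ?thesis using b by (simp add: smooth_on_def)
  qed
  ultimately show ?thesis using assms(1) by (simp only:) (intro smooth_intros)
qed

lemma riemannian_g_sasaki: "riemannian_metric g_sasaki"
proof -
  have "bilinear (g_sasaki p)" for p
    by (auto simp: bilinear_def g_sasaki_def \<eta>_def algebra_simps add_divide_distrib diff_divide_distrib intro!: linearI)
  moreover have "g_sasaki p v v > 0" if "v \<noteq> 0" for p v
  proof (rule ccontr)
    assume "\<not> g_sasaki p v v > 0"
    then have a: "(v $ 1 * v $ 1 + v $ 2 * v $ 2) / 4 + \<eta> p v * \<eta> p v \<le> 0" by (simp add: g_sasaki_def)
    moreover have "0 \<le> v $ 1 * v $ 1" "0 \<le> v $ 2 * v $ 2" "0 \<le> \<eta> p v * \<eta> p v" by simp_all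
    ultimately have "v $ 1 * v $ 1 = 0" "v $ 2 * v $ 2 = 0" "\<eta> p v * \<eta> p v = 0"
      by argo+
    then have "v = 0" by (simp add: vec_eq_iff forall_3 \<eta>_def)
    with that show False by simp
  qed
  moreover have "g_sasaki p v w = g_sasaki p w v" for p v w by (simp add: g_sasaki_def)
  moreover have "smooth_on UNIV (\<lambda>p. g_sasaki p v w)" for v w
  proof -
    have "(\<lambda>p. g_sasaki p v w) = (\<lambda>p. (v $ 1 * w $ 1 + v $ 2 * w $ 2) / 4 +
       (v $ 3 / 2 + (- v $ 1 / 2) * p $ 2) * (w $ 3 / 2 + (- w $ 1 / 2) * p $ 2))"
      by (simp add: g_sasaki_def \<eta>_def field_simps)
    then show ?thesis by (simp only:) (intro smooth_intros)
  qed
  ultimately show ?thesis unfolding riemannian_metric_def by blast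
qed

lemma levi_civita_g_sasaki_exists: "\<exists>D. levi_civita_connection g_sasaki D"
proof -
  define c1 :: "real^3 \<Rightarrow> real^3 \<Rightarrow> real^3 \<Rightarrow> real" where "c1 = (\<lambda>p v w. (1/2) * p$2 * (v$1 * w$2 + v$2 * w$1) + (- 1/2) * (v$2 * w$3 + v$3 * w$2))"
  define c2 :: "real^3 \<Rightarrow> real^3 \<Rightarrow> real^3 \<Rightarrow> real" where "c2 = (\<lambda>p v w. (- 1) * p$2 * (v$1 * w$1) + (1/2) * (v$1 * w$3 + v$3 * w$1))"
  define c3 :: "real^3 \<Rightarrow> real^3 \<Rightarrow> real^3 \<Rightarrow> real" where "c3 = (\<lambda>p v w. ((1/2) * (p$2 * p$2) + (- 1/2)) * (v$1 * w$2 + v$2 * w$1) + (- 1/2) * p$2 * (v$2 * w$3 + v$3 * w$2))"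
  define G where "G = (\<lambda>p v w. c1 p v w *\<^sub>R axis 1 1 + c2 p v w *\<^sub>R axis 2 1 + c3 p v w *\<^sub>R (axis 3 1 :: real^3))"
  define D :: connection where "D = (\<lambda>V W p. frechet_derivative W (at p) (V p) + G p (V p) (W p))"
  note cs = c1_def c2_def c3_def
  have Gn: "G p v w $ 1 = c1 p v w" "G p v w $ 2 = c2 p v w" "G p v w $ 3 = c3 p v w" for p v w
    by (simp_all add: G_def axis_def)
  have G: "G p (v + v') w = G p v w + G p v' w" "G p v (w + w') = G p v w + G p v w'"
    "G p (r *\<^sub>R v) w = r *\<^sub>R G p v w" "G p v (r *\<^sub>R w) = r *\<^sub>R G p v w" "G p v w = G p w v" for p v v' w w' r
    by (simp_all add: vec_eq_iff forall_3 Gn cs algebra_simps add_divide_distrib)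
  have hd: "(W has_derivative frechet_derivative W (at p)) (at p)" if "smooth_on UNIV W"
    for W :: "real^3 \<Rightarrow> 'b::real_normed_vector" and p
    using smooth_on_differentiable[OF that] frechet_derivative_works by blast
  have lin: "linear (frechet_derivative W (at p))" if "smooth_on UNIV W" for W :: vfield and p
    using hd[OF that] by (rule has_derivative_linear)
  have "smooth_on UNIV (D V W)" if "smooth_on UNIV V" "smooth_on UNIV W" for V W
    unfolding D_def G_def cs using that by (intro smooth_intros smooth_on_directional)
  moreover have "D V (\<lambda>p. W p + W' p) = (\<lambda>p. D V W p + D V W' p)"
    if "smooth_on UNIV V" "smooth_on UNIV W" "smooth_on UNIV W'" for V W W'
  proof
    fix p
    show "D V (\<lambda>p. W p + W' p) p = D V W p + D V W' p"
      using frechet_derivative_at[OF has_derivative_add[OF hd[OF that(2)] hd[OF that(3)]], of p, symmetric]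
      by (simp add: D_def G)
  qed
  moreover have "D V (\<lambda>p. f p *\<^sub>R W p) = (\<lambda>p. f p *\<^sub>R D V W p + frechet_derivative f (at p) (V p) *\<^sub>R W p)"
    if "smooth_on UNIV f" "smooth_on UNIV V" "smooth_on UNIV W" for f :: "real^3 \<Rightarrow> real" and V W
  proof
    fix p
    show "D V (\<lambda>p. f p *\<^sub>R W p) p = f p *\<^sub>R D V W p + frechet_derivative f (at p) (V p) *\<^sub>R W p"
      using frechet_derivative_at[OF has_derivative_scaleR[OF hd[OF that(1)] hd[OF that(3)]], of p, symmetric]
      by (simp add: D_def G algebra_simps)
  qed
  ultimately have "affine_connection D"
    unfolding affine_connection_def
    by (auto simp: D_def G fun_eq_iff linear_add[OF lin] linear_scale[OF lin] algebra_simps)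
  moreover have "torsion_free D"
    unfolding torsion_free_def D_def lie_bracket_def using G(5) by simp
  moreover have "metric_compatible g_sasaki D"
    unfolding metric_compatible_def
  proof (intro allI impI)
    fix X V W :: vfield and p
    assume s: "smooth_on UNIV X" "smooth_on UNIV V" "smooth_on UNIV W"
    let ?V = "frechet_derivative V (at p)" and ?W = "frechet_derivative W (at p)"
    have "((\<lambda>q. g_sasaki q (V q) (W q)) has_derivative (\<lambda>x.
       (V p$1 * ?W x$1 + ?V x$1 * W p$1 + (V p$2 * ?W x$2 + ?V x$2 * W p$2)) / 4 +
       (\<eta> p (V p) * ((?W x$3 - (p$2 * ?W x$1 + x$2 * W p$1)) / 2) +
        ((?V x$3 - (p$2 * ?V x$1 + x$2 * V p$1)) / 2) * \<eta> p (W p)))) (at p)"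
      unfolding g_sasaki_def \<eta>_def
      by (rule derivative_eq_intros bounded_linear.has_derivative[OF bounded_linear_vec_nth]
        hd[OF s(2)] hd[OF s(3)] refl | simp)+
    from frechet_derivative_at[OF this, symmetric]
    show "frechet_derivative (\<lambda>q. g_sasaki q (V q) (W q)) (at p) (X p) =
            g_sasaki p (D X V p) (W p) + g_sasaki p (V p) (D X W p)"
      by (simp add: g_sasaki_def \<eta>_def D_def Gn cs) (simp add: field_simps)
  qed
  ultimately show ?thesis unfolding levi_civita_connection_def by blast
qed

lemma cov_deriv_along_compose:
  assumes D: "affine_connection D" and V: "smooth_on UNIV V" and W: "smooth_on UNIV W"
    and \<gamma>: "\<gamma> differentiable at s" and T: "tangent \<gamma> s = V (\<gamma> s)"
  shows "cov_deriv_along D \<gamma> (\<lambda>t. W (\<gamma> t)) s = D V W (\<gamma> s)"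
proof -
  let ?e = "\<lambda>i::3. (\<lambda>_. axis i 1) :: vfield"
  have add1: "D (\<lambda>p. X p + X' p) Z = (\<lambda>p. D X Z p + D X' Z p)"
    and add2: "D Z (\<lambda>p. X p + X' p) = (\<lambda>p. D Z X p + D Z X' p)"
    if "smooth_on UNIV X" "smooth_on UNIV X'" "smooth_on UNIV Z" for X X' Z
    using D that unfolding affine_connection_def by blast+
  have scale1: "D (\<lambda>p. f p *\<^sub>R X p) Z = (\<lambda>p. f p *\<^sub>R D X Z p)"
    and scale2: "D Z (\<lambda>p. f p *\<^sub>R X p) =
          (\<lambda>p. f p *\<^sub>R D Z X p + frechet_derivative f (at p) (Z p) *\<^sub>R X p)"
    if "smooth_on UNIV f" "smooth_on UNIV X" "smooth_on UNIV Z" for f :: "real^3 \<Rightarrow> real" and X Z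
    using D that unfolding affine_connection_def by blast+
  have e: "Z = (\<lambda>p. Z p $ 1 *\<^sub>R ?e 1 p + (Z p $ 2 *\<^sub>R ?e 2 p + Z p $ 3 *\<^sub>R ?e 3 p))" for Z :: vfield
    by (simp add: fun_eq_iff vec_eq_iff forall_3 axis_def)
  have sc: "smooth_on UNIV (\<lambda>p. Z p $ i)" if "smooth_on UNIV Z" for Z :: vfield and i
    using that by (intro smooth_intros)
  have L: "D V Z p = V p $ 1 *\<^sub>R D (?e 1) Z p + V p $ 2 *\<^sub>R D (?e 2) Z p + V p $ 3 *\<^sub>R D (?e 3) Z p"
    if Z: "smooth_on UNIV Z" for Z p
  proof -
    have c: "smooth_on UNIV (\<lambda>p. V p $ i *\<^sub>R ?e i p)" for i
      by (intro smooth_intros V)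
    have "D V Z = D (\<lambda>p. V p $ 1 *\<^sub>R ?e 1 p + (V p $ 2 *\<^sub>R ?e 2 p + V p $ 3 *\<^sub>R ?e 3 p)) Z"
      by (rule arg_cong[where f = "\<lambda>X. D X Z", OF e])
    then show ?thesis
      unfolding add1[OF c smooth_on_add[OF c c] Z] add1[OF c c Z]
        scale1[OF sc[OF V] smooth_on_const Z] by (simp add: add.assoc)
  qed
  have dW: "(W has_derivative frechet_derivative W (at p)) (at p)" for p
    using smooth_on_differentiable[OF W] frechet_derivative_works by blast
  have dWi: "frechet_derivative (\<lambda>p. W p $ i) (at p) v = frechet_derivative W (at p) v $ i" for i p v
  proof -
    have "((\<lambda>p. W p $ i) has_derivative (\<lambda>v. frechet_derivative W (at p) v $ i)) (at p)"
      by (rule bounded_linear.has_derivative[OF bounded_linear_vec_nth dW])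
    from frechet_derivative_at[OF this, symmetric] show ?thesis by simp
  qed
  have R: "D X W p = frechet_derivative W (at p) (X p) +
      (W p $ 1 *\<^sub>R D X (?e 1) p + W p $ 2 *\<^sub>R D X (?e 2) p + W p $ 3 *\<^sub>R D X (?e 3) p)"
    if X: "smooth_on UNIV X" for X p
  proof -
    have c: "smooth_on UNIV (\<lambda>p. W p $ i *\<^sub>R ?e i p)" for i
      by (intro smooth_intros W)
    have m: "D X (\<lambda>p. W p $ i *\<^sub>R ?e i p) p =
       W p $ i *\<^sub>R D X (?e i) p + (frechet_derivative W (at p) (X p) $ i) *\<^sub>R axis i 1" for i
      unfolding scale2[OF sc[OF W] smooth_on_const X] dWi ..
    have "D X W = D X (\<lambda>p. W p $ 1 *\<^sub>R ?e 1 p + (W p $ 2 *\<^sub>R ?e 2 p + W p $ 3 *\<^sub>R ?e 3 p))"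
      by (rule arg_cong[where f = "D X", OF e])
    then have "D X W p = D X (\<lambda>p. W p $ 1 *\<^sub>R ?e 1 p) p + (D X (\<lambda>p. W p $ 2 *\<^sub>R ?e 2 p) p + D X (\<lambda>p. W p $ 3 *\<^sub>R ?e 3 p) p)"
      unfolding add2[OF c smooth_on_add[OF c c] X] add2[OF c c X] by simp
    then show ?thesis
      unfolding m by (simp add: vec_eq_iff forall_3 axis_def)
  qed
  have "((\<lambda>t. W (\<gamma> t)) has_vector_derivative frechet_derivative W (at (\<gamma> s)) (tangent \<gamma> s)) (at s)"
    using vector_derivative_diff_chain_within[of \<gamma> "tangent \<gamma> s" s UNIV W] \<gamma> dW
    by (auto simp: tangent_def o_def vector_derivative_works intro: has_derivative_at_withinI)
  then have "vector_derivative (\<lambda>t. W (\<gamma> t)) (at s) = frechet_derivative W (at (\<gamma> s)) (V (\<gamma> s))"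
    using T by (simp add: vector_derivative_at)
  then show ?thesis
    unfolding cov_deriv_along_def R[OF V] T
    by (simp add: sum_3 L smooth_on_const algebra_simps)
qed

lemma cov_deriv_along_semi_symmetric:
  assumes "bilinear (g (\<gamma> s))"
  shows "cov_deriv_along (semi_symmetric_connection g U D) \<gamma> W s =
    cov_deriv_along D \<gamma> W s + g (\<gamma> s) (W s) (U (\<gamma> s)) *\<^sub>R tangent \<gamma> s
      - g (\<gamma> s) (tangent \<gamma> s) (W s) *\<^sub>R U (\<gamma> s)"
proof -
  have e: "v = v $ 1 *\<^sub>R axis 1 1 + v $ 2 *\<^sub>R axis 2 1 + v $ 3 *\<^sub>R axis 3 1" for v :: "real^3"
    by (simp add: vec_eq_iff forall_3 axis_def)
  let ?g = "g (\<gamma> s)" and ?T = "tangent \<gamma> s"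
  have l: "?g v w = v $ 1 * ?g (axis 1 1) w + v $ 2 * ?g (axis 2 1) w + v $ 3 * ?g (axis 3 1) w" for v w
    by (subst e[of v]) (simp add: bilinear_ladd[OF assms] bilinear_lmul[OF assms])
  have r: "?g v w = w $ 1 * ?g v (axis 1 1) + w $ 2 * ?g v (axis 2 1) + w $ 3 * ?g v (axis 3 1)" for v w
    by (subst e[of w]) (simp add: bilinear_radd[OF assms] bilinear_rmul[OF assms])
  have W: "?g (W s) (U (\<gamma> s)) = (\<Sum>j\<in>UNIV. W s $ j * ?g (axis j 1) (U (\<gamma> s)))"
    using l[of "W s"] by (simp add: sum_3)
  have T: "?g ?T (W s) = (\<Sum>i\<in>UNIV. \<Sum>j\<in>UNIV. ?T $ i * W s $ j * ?g (axis i 1) (axis j 1))"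
    using l[of ?T "W s"] r[of "axis 1 1" "W s"] r[of "axis 2 1" "W s"] r[of "axis 3 1" "W s"]
    by (simp add: sum_3 algebra_simps)
  show ?thesis
  proof -
    have "(\<Sum>i\<in>UNIV. \<Sum>j\<in>UNIV. (?T $ i * W s $ j) *\<^sub>R (?g (axis j 1) (U (\<gamma> s)) *\<^sub>R axis i 1))
        = ?g (W s) (U (\<gamma> s)) *\<^sub>R (\<Sum>i\<in>UNIV. ?T $ i *\<^sub>R (axis i 1 :: real^3))"
      unfolding W scaleR_sum_right scaleR_sum_left by (simp add: sum_distrib_left mult_ac)
    also have "(\<Sum>i\<in>UNIV. ?T $ i *\<^sub>R (axis i 1 :: real^3)) = ?T"
      unfolding sum_3 by (rule e[symmetric])
    finally have 1: "(\<Sum>i\<in>UNIV. \<Sum>j\<in>UNIV. (?T $ i * W s $ j) *\<^sub>R (?g (axis j 1) (U (\<gamma> s)) *\<^sub>R axis i 1))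
        = ?g (W s) (U (\<gamma> s)) *\<^sub>R ?T" .
    have 2: "(\<Sum>i\<in>UNIV. \<Sum>j\<in>UNIV. (?T $ i * W s $ j) *\<^sub>R (?g (axis i 1) (axis j 1) *\<^sub>R U (\<gamma> s)))
        = ?g ?T (W s) *\<^sub>R U (\<gamma> s)"
      unfolding T scaleR_sum_left by simp
    show ?thesis
      unfolding cov_deriv_along_def semi_symmetric_connection_def 1[symmetric] 2[symmetric]
      by (simp only: scaleR_add_right scaleR_diff_right sum.distrib sum_subtractf add.assoc add_diff_eq)
  qed
qed

lemma xi_unit: "g_sasaki p (\<xi> p) (\<xi> p) = 1"
  by (simp add: g_sasaki_def \<eta>_def \<xi>_def axis_def)

end

theory Submission
  imports Defs
begin

text \<open>
  Every Frenet curve is smooth and of unit speed, so the equivalence is the equality, up to an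
  invertible linear map, of the coordinate expression of the acceleration with the left-hand sides
  of the system; the last equation of the system is the unit-speed condition written out.

  Only the axioms of the Levi-Civita connection are given, so its values on constant fields have to
  be computed: all brackets of such fields vanish, the Koszul formula
  (\<open>koszul_formula_constant_fields\<close>) reduces to derivatives of the coefficients of the metric, and
  \<open>\<eta>\<close> depends on the second coordinate only, which yields the Christoffel symbols
  (\<open>levi_civita_constant_fields\<close>).
  The acceleration then has the components \<open>\<mu>\<close>, \<open>\<lambda>\<close> and a third one, \<open>a\<^sub>3\<close>.  Instead of \<open>a\<^sub>3\<close>
  one looks at \<open>2 \<eta>(a) = a\<^sub>3 - \<gamma>\<^sub>2 a\<^sub>1\<close>, which equals
  \<open>\<gamma>\<^sub>3'' - \<gamma>\<^sub>2 \<gamma>\<^sub>1'' - \<gamma>\<^sub>1' \<gamma>\<^sub>2' + (\<gamma>\<^sub>3' - \<gamma>\<^sub>1' \<gamma>\<^sub>2)\<^sup>2 / 2 - 2\<close>, and replaces the square by means of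
  the unit-speed condition: the result is \<open>\<nu>\<close> (\<open>accel_eq_0_iff_ode\<close>).
\<close>

section \<open>Christoffel symbols\<close>

text \<open>
  Adding the compatibility equations for \<open>(u, v, w)\<close> and \<open>(v, u, w)\<close> and subtracting the one for
  \<open>(w, u, v)\<close> leaves only the two terms \<open>g(D\<^sub>u v, w)\<close> and \<open>g(D\<^sub>v u, w)\<close>; these agree, because a
  torsion-free \<open>D\<close> is symmetric on commuting fields.
\<close>

lemma koszul_formula_constant_fields:
  assumes D: "levi_civita_connection g D" and g: "riemannian_metric g"
  shows "2 * g p (D (\<lambda>_. u) (\<lambda>_. v) p) w =
    frechet_derivative (\<lambda>q. g q v w) (at p) u + frechet_derivative (\<lambda>q. g q u w) (at p) v
    - frechet_derivative (\<lambda>q. g q u v) (at p) w"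
proof -
  have compat: "frechet_derivative (\<lambda>q. g q b c) (at p) a =
      g p (D (\<lambda>_. a) (\<lambda>_. b) p) c + g p b (D (\<lambda>_. a) (\<lambda>_. c) p)" for a b c
    using D smooth_on_const unfolding levi_civita_connection_def metric_compatible_def by blast
  have const: "frechet_derivative (\<lambda>_::real^3. a::real^3) (at p) = (\<lambda>_. 0)" for a
    by (rule frechet_derivative_at[symmetric]) simp
  have "D (\<lambda>_. a) (\<lambda>_. b) p - D (\<lambda>_. b) (\<lambda>_. a) p = lie_bracket (\<lambda>_. a) (\<lambda>_. b) p" for a b
    using D smooth_on_const unfolding levi_civita_connection_def torsion_free_def by blast
  then have torsion: "D (\<lambda>_. a) (\<lambda>_. b) p = D (\<lambda>_. b) (\<lambda>_. a) p" for a b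
    by (simp add: lie_bracket_def const)
  have sym: "g p a b = g p b a" for a b
    using g unfolding riemannian_metric_def by blast
  show ?thesis
    using compat[of v w u] compat[of u w v] compat[of u v w]
      torsion[of w u] torsion[of w v] torsion[of v u]
      sym[of v "D (\<lambda>_. u) (\<lambda>_. w) p"] sym[of u "D (\<lambda>_. v) (\<lambda>_. w) p"]
    by simp
qed

lemma frechet_derivative_g_sasaki:
  "frechet_derivative (\<lambda>q. g_sasaki q u v) (at p) w =
    - (w $ 2 / 2) * (u $ 1 * \<eta> p v + v $ 1 * \<eta> p u)"
proof -
  have eta: "((\<lambda>q. \<eta> q v) has_derivative (\<lambda>w. - (w $ 2 * v $ 1) / 2)) (at p)" for v
  proof -
    have "((\<lambda>q. q $ 2) has_derivative (\<lambda>w. w $ 2)) (at p)"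
      by (rule bounded_linear_imp_has_derivative[OF bounded_linear_vec_nth])
    then show ?thesis
      unfolding \<eta>_def by (auto intro!: derivative_eq_intros)
  qed
  have "((\<lambda>q. g_sasaki q u v) has_derivative
      (\<lambda>w. \<eta> p u * (- (w $ 2 * v $ 1) / 2) + (- (w $ 2 * u $ 1) / 2) * \<eta> p v)) (at p)"
    unfolding g_sasaki_def
    using has_derivative_add[OF has_derivative_const has_derivative_mult[OF eta eta]] by simp
  from frechet_derivative_at[OF this, symmetric] show ?thesis by (simp add: algebra_simps)
qed

definition christoffel :: "real^3 \<Rightarrow> real^3 \<Rightarrow> real^3 \<Rightarrow> real^3" where
  "christoffel p v w = vector
     [(p$2 * (v$1 * w$2 + v$2 * w$1) - (v$2 * w$3 + v$3 * w$2)) / 2,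
      (v$1 * w$3 + v$3 * w$1) / 2 - p$2 * (v$1 * w$1),
      (((p$2)\<^sup>2 - 1) * (v$1 * w$2 + v$2 * w$1) - p$2 * (v$2 * w$3 + v$3 * w$2)) / 2]"

text \<open>
  The Koszul formula gives the inner products of the covariant derivative with all constant
  fields; since the metric is nondegenerate, testing against a frame at \<open>p\<close> suffices.  The frame
  \<open>\<partial>\<^sub>1 + y \<partial>\<^sub>3, \<partial>\<^sub>2, \<partial>\<^sub>3\<close> is orthogonal, so each test determines one coefficient directly.
\<close>

lemma levi_civita_constant_fields:
  assumes D: "levi_civita_connection g_sasaki D"
  shows "D (\<lambda>_. u) (\<lambda>_. v) p = christoffel p u v"
proof -
  let ?G = "D (\<lambda>_. u) (\<lambda>_. v) p"
  have inner: "2 * g_sasaki p ?G w = - (u $ 2 / 2) * (v $ 1 * \<eta> p w + w $ 1 * \<eta> p v)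
      - (v $ 2 / 2) * (u $ 1 * \<eta> p w + w $ 1 * \<eta> p u)
      + (w $ 2 / 2) * (u $ 1 * \<eta> p v + v $ 1 * \<eta> p u)" for w
    unfolding koszul_formula_constant_fields[OF D riemannian_g_sasaki] frechet_derivative_g_sasaki
    by simp
  \<comment> \<open>As \<open>\<partial>\<^sub>3 = \<xi> / 2\<close>, pairing with it gives half the value of \<open>\<eta>\<close>.\<close>
  have eta: "\<eta> p ?G = - (u $ 2 * v $ 1 + v $ 2 * u $ 1) / 4"
    using inner[of "axis 3 1"] by (simp add: g_sasaki_def \<eta>_def axis_def field_simps)
  have 2: "?G $ 2 = u $ 1 * \<eta> p v + v $ 1 * \<eta> p u"
    using inner[of "axis 2 1"] by (simp add: g_sasaki_def \<eta>_def axis_def)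
  \<comment> \<open>The field \<open>\<partial>\<^sub>1 + y \<partial>\<^sub>3\<close> lies in the kernel of \<open>\<eta>\<close>, so only the first component is seen.\<close>
  have 1: "?G $ 1 = - (u $ 2 * \<eta> p v + v $ 2 * \<eta> p u)"
    using inner[of "axis 1 1 + p $ 2 *\<^sub>R axis 3 1"] by (simp add: g_sasaki_def \<eta>_def axis_def)
  have 3: "?G $ 3 = p $ 2 * ?G $ 1 - (u $ 2 * v $ 1 + v $ 2 * u $ 1) / 2"
    using eta unfolding \<eta>_def by argo
  show ?thesis
    by (simp add: vec_eq_iff forall_3 christoffel_def 1 2 3 \<eta>_def)
      (simp add: field_simps power2_eq_square)
qed

lemma cov_deriv_along_levi_civita:
  assumes "levi_civita_connection g_sasaki D"
  shows "cov_deriv_along D \<gamma> W s =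
    vector_derivative W (at s) + christoffel (\<gamma> s) (tangent \<gamma> s) (W s)"
  unfolding cov_deriv_along_def levi_civita_constant_fields[OF assms]
  by (simp add: sum_3 vec_eq_iff forall_3 christoffel_def axis_def) (simp add: field_simps)

section \<open>Derivatives of the components of a curve\<close>

lemma has_vector_derivative_tangent:
  assumes "smooth_on I \<gamma>" "s \<in> I"
  shows "(\<gamma> has_vector_derivative tangent \<gamma> s) (at s)"
  using smooth_on_differentiable[OF assms] by (simp add: tangent_def vector_derivative_works)

text \<open>
  Smoothness speaks of the Frechet derivative in direction \<open>1\<close>, which agrees with the tangent
  vector only where the curve is differentiable; openness of \<open>I\<close> makes this a neighbourhood.
\<close>

lemma has_vector_derivative_velocity:
  assumes "open I" "smooth_on I \<gamma>" "s \<in> I"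
  shows "(tangent \<gamma> has_vector_derivative vector_derivative (tangent \<gamma>) (at s)) (at s)"
proof -
  have "Ck_on (Suc (Suc 0)) I \<gamma>" using assms(2) unfolding smooth_on_def by blast
  then have "(\<lambda>t. frechet_derivative \<gamma> (at t) 1) differentiable at s"
    using assms(3) by simp
  moreover have "frechet_derivative \<gamma> (at t) 1 = tangent \<gamma> t" if "t \<in> I" for t
  proof -
    have "(\<gamma> has_derivative (\<lambda>x. x *\<^sub>R tangent \<gamma> t)) (at t)"
      using has_vector_derivative_tangent[OF assms(2) that]
      by (simp add: has_vector_derivative_def)
    from frechet_derivative_at[OF this, symmetric] show ?thesis by simp
  qed
  ultimately have "tangent \<gamma> differentiable at s"
    using has_derivative_transform_within_open[OF _ assms(1,3)] unfolding differentiable_def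
    by blast
  then show ?thesis by (simp add: vector_derivative_works)
qed

lemma deriv_vec_nth:
  fixes f :: "real \<Rightarrow> real^'n"
  assumes "(f has_vector_derivative f') (at s)"
  shows "deriv (\<lambda>t. f t $ i) s = f' $ i"
proof -
  have "((\<lambda>t. f t $ i) has_vector_derivative f' $ i) (at s)"
    using bounded_linear.has_vector_derivative[OF bounded_linear_vec_nth assms] .
  then show ?thesis
    by (simp add: DERIV_imp_deriv has_real_derivative_iff_has_vector_derivative)
qed

lemma deriv_component:
  assumes "smooth_on I \<gamma>" "s \<in> I"
  shows "deriv (\<lambda>t. \<gamma> t $ i) s = tangent \<gamma> s $ i"
  by (rule deriv_vec_nth[OF has_vector_derivative_tangent[OF assms]])

lemma deriv_deriv_component:
  assumes "open I" "smooth_on I \<gamma>" "s \<in> I"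
  shows "deriv (deriv (\<lambda>t. \<gamma> t $ i)) s = vector_derivative (tangent \<gamma>) (at s) $ i"
proof -
  have "\<forall>\<^sub>F t in nhds s. deriv (\<lambda>t. \<gamma> t $ i) t = tangent \<gamma> t $ i"
    using eventually_nhds_in_open[OF assms(1,3)]
    by eventually_elim (rule deriv_component[OF assms(2)])
  then have "deriv (deriv (\<lambda>t. \<gamma> t $ i)) s = deriv (\<lambda>t. tangent \<gamma> t $ i) s"
    by (rule deriv_cong_ev) simp
  then show ?thesis
    using deriv_vec_nth[OF has_vector_derivative_velocity[OF assms]] by simp
qed

section \<open>The geodesic equations\<close>

lemma unit_speed_iff:
  "sqrt (g_sasaki p v v) = 1 \<longleftrightarrow> (v $ 1)\<^sup>2 + (v $ 2)\<^sup>2 + (v $ 3 - v $ 1 * p $ 2)\<^sup>2 = 4"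
proof -
  have "4 * g_sasaki p v v = (v $ 1)\<^sup>2 + (v $ 2)\<^sup>2 + (v $ 3 - v $ 1 * p $ 2)\<^sup>2"
    by (simp add: g_sasaki_def \<eta>_def power2_eq_square field_simps)
  then show ?thesis unfolding real_sqrt_eq_1_iff by argo
qed

text \<open>
  For a unit-speed curve the semi-symmetric correction is \<open>\<eta>(T) T - \<xi>\<close>, and
  \<open>(\<mu>, \<lambda>, \<nu>) = (a\<^sub>1, a\<^sub>2, a\<^sub>3 - \<gamma>\<^sub>2 a\<^sub>1)\<close> is the image of the acceleration under an invertible
  linear map.
\<close>

lemma accel_eq_0_iff_ode:
  assumes D: "levi_civita_connection g_sasaki D"
    and "open I" "s \<in> I" and \<gamma>: "unit_speed_curve g_sasaki I \<gamma>"
  shows "accel (semi_symmetric_connection g_sasaki \<xi> D) \<gamma> s = 0 \<longleftrightarrow>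
    ode_lambda (\<lambda>t. \<gamma> t $ 1) (\<lambda>t. \<gamma> t $ 2) (\<lambda>t. \<gamma> t $ 3) s = 0 \<and>
    ode_mu (\<lambda>t. \<gamma> t $ 1) (\<lambda>t. \<gamma> t $ 2) (\<lambda>t. \<gamma> t $ 3) s = 0 \<and>
    ode_nu (\<lambda>t. \<gamma> t $ 1) (\<lambda>t. \<gamma> t $ 2) (\<lambda>t. \<gamma> t $ 3) s = 0"
proof -
  have smooth: "smooth_on I \<gamma>" using \<gamma> unfolding unit_speed_curve_def by blast
  note derivs = deriv_component[OF smooth \<open>s \<in> I\<close>]
    deriv_deriv_component[OF \<open>open I\<close> smooth \<open>s \<in> I\<close>]
  let ?T = "tangent \<gamma> s" and ?y = "\<gamma> s $ 2"
  let ?a = "accel (semi_symmetric_connection g_sasaki \<xi> D) \<gamma> s"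
  have speed: "sqrt (g_sasaki (\<gamma> s) ?T ?T) = 1"
    using \<gamma> \<open>s \<in> I\<close> unfolding unit_speed_curve_def by blast
  then have unit: "g_sasaki (\<gamma> s) ?T ?T = 1" by simp
  have bil: "bilinear (g_sasaki (\<gamma> s))"
    using riemannian_g_sasaki unfolding riemannian_metric_def by blast
  have xi: "g_sasaki p v (\<xi> p) = \<eta> p v" for p v
    by (simp add: g_sasaki_def \<eta>_def \<xi>_def axis_def)
  have a: "?a = vector_derivative (tangent \<gamma>) (at s) + christoffel (\<gamma> s) ?T ?T
      + \<eta> (\<gamma> s) ?T *\<^sub>R ?T - \<xi> (\<gamma> s)"
    unfolding accel_def cov_deriv_along_semi_symmetric[where g = g_sasaki and \<gamma> = \<gamma> and s = s, OF bil]
      cov_deriv_along_levi_civita[OF D] xi unit by simp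
  have 1: "?a $ 1 = ode_mu (\<lambda>t. \<gamma> t $ 1) (\<lambda>t. \<gamma> t $ 2) (\<lambda>t. \<gamma> t $ 3) s"
    unfolding ode_mu_def derivs a
    by (simp add: christoffel_def \<eta>_def \<xi>_def axis_def) (simp add: field_simps power2_eq_square)
  have 2: "?a $ 2 = ode_lambda (\<lambda>t. \<gamma> t $ 1) (\<lambda>t. \<gamma> t $ 2) (\<lambda>t. \<gamma> t $ 3) s"
    unfolding ode_lambda_def derivs a
    by (simp add: christoffel_def \<eta>_def \<xi>_def axis_def) (simp add: field_simps power2_eq_square)
  have "?a $ 3 - ?y * ?a $ 1 =
      ode_nu (\<lambda>t. \<gamma> t $ 1) (\<lambda>t. \<gamma> t $ 2) (\<lambda>t. \<gamma> t $ 3) s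
      + ((?T $ 1)\<^sup>2 + (?T $ 2)\<^sup>2 + (?T $ 3 - ?T $ 1 * ?y)\<^sup>2 - 4) / 2"
    unfolding ode_nu_def derivs a
    by (simp add: christoffel_def \<eta>_def \<xi>_def axis_def) (simp add: field_simps power2_eq_square)
  then have 3: "?a $ 3 = ?y * ?a $ 1 + ode_nu (\<lambda>t. \<gamma> t $ 1) (\<lambda>t. \<gamma> t $ 2) (\<lambda>t. \<gamma> t $ 3) s"
    using speed unfolding unit_speed_iff by simp
  show ?thesis
    unfolding vec_eq_iff forall_3 using 1 2 3 by auto
qed

theorem theorem2:
  fixes I :: "real set" and \<gamma> :: "real \<Rightarrow> real^3" and \<gamma>1 \<gamma>2 \<gamma>3 :: "real \<Rightarrow> real"
    and nabla :: connection and nabla_tilde :: connection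
  assumes interval: "open I" "is_interval I" "I \<noteq> {}"
    and levi_civita: "levi_civita_connection g_sasaki nabla"
    and nabla_tilde: "nabla_tilde = semi_symmetric_connection g_sasaki \<xi> nabla"
    and components: "\<gamma> = (\<lambda>s. vector [\<gamma>1 s, \<gamma>2 s, \<gamma>3 s])"
    and frenet: "frenet_curve g_sasaki nabla_tilde I \<gamma>"
  shows "geodesic g_sasaki nabla_tilde I \<gamma> \<longleftrightarrow>
    (\<forall>s\<in>I. ode_lambda \<gamma>1 \<gamma>2 \<gamma>3 s = 0 \<and> ode_mu \<gamma>1 \<gamma>2 \<gamma>3 s = 0 \<and> ode_nu \<gamma>1 \<gamma>2 \<gamma>3 s = 0 \<and>
       (deriv \<gamma>1 s)\<^sup>2 + (deriv \<gamma>2 s)\<^sup>2 + (deriv \<gamma>3 s - deriv \<gamma>1 s * \<gamma>2 s)\<^sup>2 = 4)"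
proof -
  have \<gamma>: "unit_speed_curve g_sasaki I \<gamma>"
    using frenet unfolding frenet_curve_def geodesic_def frenet_order2_def frenet_order3_def
    by blast
  then have smooth: "smooth_on I \<gamma>"
    and speed: "\<And>s. s \<in> I \<Longrightarrow> sqrt (g_sasaki (\<gamma> s) (tangent \<gamma> s) (tangent \<gamma> s)) = 1"
    unfolding unit_speed_curve_def by blast+
  have nth: "\<gamma>1 = (\<lambda>s. \<gamma> s $ 1)" "\<gamma>2 = (\<lambda>s. \<gamma> s $ 2)" "\<gamma>3 = (\<lambda>s. \<gamma> s $ 3)"
    by (simp_all add: components)
  have speed_eq: "(deriv \<gamma>1 s)\<^sup>2 + (deriv \<gamma>2 s)\<^sup>2 + (deriv \<gamma>3 s - deriv \<gamma>1 s * \<gamma>2 s)\<^sup>2 = 4"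
    if "s \<in> I" for s
    using speed[OF that] unfolding unit_speed_iff nth deriv_component[OF smooth that] .
  have "accel nabla_tilde \<gamma> s = 0 \<longleftrightarrow>
      ode_lambda \<gamma>1 \<gamma>2 \<gamma>3 s = 0 \<and> ode_mu \<gamma>1 \<gamma>2 \<gamma>3 s = 0 \<and> ode_nu \<gamma>1 \<gamma>2 \<gamma>3 s = 0"
    if "s \<in> I" for s
    unfolding nabla_tilde nth by (rule accel_eq_0_iff_ode[OF levi_civita interval(1) that \<gamma>])
  then show ?thesis
    unfolding geodesic_def using \<gamma> speed_eq by blast
qed

end
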